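(* Let $H$ be a complex Hilbert space, and let $T$ be an injective bounded linear operator on $H$ such that $W(T^{-1})=\{z\in\mathbb{C}:\operatorname{Re} z\ge 0\}$. Then, given distinct $\lambda,\mu\in\mathbb{C}$, the following statements are equivalent: (i) $I+\mu T$ is invertible and $\|(I+\lambda T)(I+\mu T)^{-1}\|=1$; (ii) $\operatorname{Re}\mu>0$ and $\lambda\in[-\overline{\mu},\mu)$.
   Context: The inner product is linear in its first argument. $I$ is the identity operator on $H$, and $\|\cdot\|$ is the operator norm. For an injective bounded operator $T$ on $H$, $T^{-1}$ denotes the (possibly unbounded) operator with domain $D(T^{-1})=T(H)$ inverse to $T$. For a (possibly unbounded) operator $A$ with domain $D(A)\subset H$, the numerical range of $A$ is $W(A):=\{\langle Ax,x\rangle : x\in D(A),\ \|x\|=1\}$. For $\mu\in\mathbb{C}$, $[-\overline{\mu},\mu)$ denotes the set $\{-(1-t)\overline{\mu}+t\mu : t\in[0,1)\}$. *)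

theory Defs
  imports "HOL-Analysis.Analysis"
begin

text \<open>
  Complex inner product spaces, with the inner product linear in its first argument.
  The law \<open>1 *\<^sub>C x = x\<close> and the positive definiteness of \<open>cinner\<close> follow from
  \<open>scaleR_scaleC\<close> and \<open>norm_eq_sqrt_cinner\<close> together with the axioms of
  \<open>real_normed_vector\<close>.
\<close>

class complex_inner = real_normed_vector +
  fixes scaleC :: "complex \<Rightarrow> 'a \<Rightarrow> 'a"  (infixr \<open>*\<^sub>C\<close> 75)
    and cinner :: "'a \<Rightarrow> 'a \<Rightarrow> complex"
  assumes scaleC_add_right: "a *\<^sub>C (x + y) = a *\<^sub>C x + a *\<^sub>C y"
    and scaleC_add_left: "(a + b) *\<^sub>C x = a *\<^sub>C x + b *\<^sub>C x"
    and scaleC_scaleC: "a *\<^sub>C (b *\<^sub>C x) = (a * b) *\<^sub>C x"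
    and scaleR_scaleC: "r *\<^sub>R x = complex_of_real r *\<^sub>C x"
    and cinner_commute: "cinner x y = cnj (cinner y x)"
    and cinner_add_left: "cinner (x + y) z = cinner x z + cinner y z"
    and cinner_scaleC_left: "cinner (a *\<^sub>C x) y = a * cinner x y"
    and norm_eq_sqrt_cinner: "norm x = sqrt (Re (cinner x x))"

class complex_hilbert = complex_inner + complete_space

instantiation complex :: complex_hilbert
begin

definition "scaleC_complex (a :: complex) (x :: complex) = a * x"
definition "cinner_complex (x :: complex) y = x * cnj y"

instance
  by standard
    (auto simp: scaleC_complex_def cinner_complex_def algebra_simps scaleR_conv_of_real
      cmod_def power2_eq_square)

end

definition bounded_clinear :: "('a::complex_inner \<Rightarrow> 'b::complex_inner) \<Rightarrow> bool" where
  "bounded_clinear T \<longleftrightarrow> bounded_linear T \<and> (\<forall>c x. T (c *\<^sub>C x) = c *\<^sub>C T x)"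

text \<open>Invertibility in the algebra of bounded operators; the inverse is then \<open>inv A\<close>.\<close>

definition invertible_op :: "('a::complex_inner \<Rightarrow> 'a) \<Rightarrow> bool" where
  "invertible_op A \<longleftrightarrow> bounded_clinear A \<and>
     (\<exists>B. bounded_clinear B \<and> A \<circ> B = id \<and> B \<circ> A = id)"

text \<open>
  A possibly unbounded operator is given by its domain \<open>D\<close> and a function \<open>A\<close>,
  whose values outside \<open>D\<close> are irrelevant.  For an injective \<open>T\<close>, the operator
  \<open>T\<^sup>-\<^sup>1\<close> is thus given by \<open>range T\<close> and \<open>inv T\<close>.
\<close>

definition numerical_range :: "'a::complex_inner set \<Rightarrow> ('a \<Rightarrow> 'a) \<Rightarrow> complex set" where
  "numerical_range D A = {cinner (A x) x | x. x \<in> D \<and> norm x = 1}"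

definition id_plus :: "complex \<Rightarrow> ('a::complex_inner \<Rightarrow> 'a) \<Rightarrow> 'a \<Rightarrow> 'a" where
  "id_plus c T = (\<lambda>x. x + c *\<^sub>C T x)"

definition reflected_segment :: "complex \<Rightarrow> complex set" where
  "reflected_segment \<mu> =
     {- complex_of_real (1 - t) * cnj \<mu> + complex_of_real t * \<mu> | t. t \<in> {0..<1}}"

end

theory Submission
  imports Defs
begin

text \<open>
  For \<open>\<parallel>T x\<parallel> = 1\<close> and \<open>w = \<langle>x, T x\<rangle>\<close> one has
  \<open>\<parallel>(I + \<lambda>T)x\<parallel>\<^sup>2 = \<parallel>x\<parallel>\<^sup>2 + 2 Re (cnj \<lambda> w) + \<bar>\<lambda>\<bar>\<^sup>2\<close>, and \<open>W(T\<^sup>-\<^sup>1)\<close> is precisely the set of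
  these \<open>w\<close>.  Hence, when \<open>I + \<mu>T\<close> is invertible, \<open>(I + \<lambda>T)(I + \<mu>T)\<^sup>-\<^sup>1\<close> is a contraction iff
  \<open>2 Re (cnj (\<mu> - \<lambda>) w) + \<bar>\<mu>\<bar>\<^sup>2 - \<bar>\<lambda>\<bar>\<^sup>2 \<ge> 0\<close> for all \<open>w\<close> in the closed right half-plane
  (\<open>id_plus_dominated_iff\<close>).  An affine function is nonnegative there only if its gradient is a
  nonnegative real, so \<open>\<lambda> = \<mu> - r\<close> with \<open>r > 0\<close>, and the constant term then says
  \<open>r \<le> 2 Re \<mu>\<close>; this is the segment (\<open>affine_nonneg_iff_reflected_segment\<close>).

  Two things remain for the converse.  The operator \<open>I + \<mu>T\<close> is invertible for \<open>Re \<mu> > 0\<close>, because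
  \<open>T\<close> is accretive, which makes \<open>cnj \<mu> (I + \<mu>T)\<close> coercive (\<open>coercive_imp_invertible\<close>, the
  Lax--Milgram argument).  And the norm of the contraction is not below 1: taking \<open>w = i n\<close>, the
  difference \<open>\<parallel>(I + \<mu>T)x\<parallel>\<^sup>2 - \<parallel>(I + \<lambda>T)x\<parallel>\<^sup>2\<close> does not depend on \<open>n\<close>, while
  \<open>\<parallel>x\<parallel> \<ge> \<bar>w\<bar> = n\<close> is unbounded (\<open>no_strict_domination\<close>).
\<close>

section \<open>Complex inner products\<close>

lemma cinner_add_right: "cinner x (y + z) = cinner x y + cinner x z"
  by (metis cinner_add_left cinner_commute complex_cnj_add)

lemma cinner_scaleC_right: "cinner x (a *\<^sub>C y) = cnj a * cinner x y"
  by (metis cinner_scaleC_left cinner_commute complex_cnj_mult)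

lemma cinner_self: "cinner x x = complex_of_real ((norm x)\<^sup>2)"
proof -
  have "Im (cinner x x) = 0"
    using cinner_commute[of x x] by (metis cnj.simps(2) equal_neg_zero)
  moreover have "Re (cinner x x) = (norm x)\<^sup>2"
  proof (cases "x = 0")
    case False
    then have "sqrt (Re (cinner x x)) > 0"
      by (metis norm_eq_sqrt_cinner zero_less_norm_iff)
    then show ?thesis
      by (simp add: norm_eq_sqrt_cinner)
  next
    case True
    then show ?thesis
      by (metis norm_eq_sqrt_cinner norm_zero real_sqrt_eq_zero_cancel_iff zero_power2)
  qed
  ultimately show ?thesis
    by (simp add: complex_eq_iff)
qed

lemma norm_add_sq: "(norm (x + y))\<^sup>2 = (norm x)\<^sup>2 + 2 * Re (cinner x y) + (norm y)\<^sup>2"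
  for x y :: "'a::complex_inner"
proof -
  have "cinner (x + y) (x + y) = cinner x x + cinner x y + cnj (cinner x y) + cinner y y"
    by (simp add: cinner_add_left cinner_add_right flip: cinner_commute[of y x])
  from arg_cong[OF this, of Re] show ?thesis
    by (simp add: cinner_self)
qed

lemma norm_scaleC: "norm (a *\<^sub>C x) = cmod a * norm x"
proof -
  have "cinner (a *\<^sub>C x) (a *\<^sub>C x) = (a * cnj a) * cinner x x"
    by (simp only: cinner_scaleC_left cinner_scaleC_right mult_ac)
  also have "\<dots> = complex_of_real ((cmod a * norm x)\<^sup>2)"
    by (simp only: cinner_self power_mult_distrib of_real_mult flip: complex_norm_square)
  finally have "cinner (a *\<^sub>C x) (a *\<^sub>C x) = complex_of_real ((cmod a * norm x)\<^sup>2)" .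
  then have "(norm (a *\<^sub>C x))\<^sup>2 = (cmod a * norm x)\<^sup>2"
    by (simp only: cinner_self of_real_eq_iff)
  then show ?thesis
    by (simp add: power2_eq_iff_nonneg)
qed

lemma scaleC_diff_right: "a *\<^sub>C (x - y) = a *\<^sub>C x - a *\<^sub>C y"
  by (metis scaleC_add_right add_diff_cancel_right' diff_add_cancel)

text \<open>
  The triangle inequality for \<open>x + y\<close>, squared, bounds the real part; multiplying \<open>x\<close> by a unit
  scalar makes the inner product real.
\<close>

lemma Cauchy_Schwarz_cinner: "cmod (cinner x y) \<le> norm x * norm y"
proof -
  have real_part: "Re (cinner u y) \<le> norm u * norm y" for u
  proof -
    have "(norm (u + y))\<^sup>2 \<le> (norm u + norm y)\<^sup>2"
      by (intro power_mono norm_triangle_ineq norm_ge_zero)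
    then show ?thesis
      by (simp add: norm_add_sq power2_sum)
  qed
  obtain a where a: "cmod a = 1" "a * cinner x y = complex_of_real (cmod (cinner x y))"
  proof (cases "cinner x y = 0")
    case True
    then show ?thesis using that[of 1] by simp
  next
    case False
    then show ?thesis
      using that[of "cnj (cinner x y) / cmod (cinner x y)"]
      by (simp add: norm_divide complex_norm_square[symmetric] mult.commute power2_eq_square
          del: complex_norm_square)
  qed
  show ?thesis
    using real_part[of "a *\<^sub>C x"] a by (simp add: cinner_scaleC_left norm_scaleC)
qed

section \<open>Coercive operators\<close>

lemma bounded_clinear_id_plus:
  assumes "bounded_clinear T"
  shows "bounded_clinear (id_plus c T)"
proof -
  have T: "bounded_linear T" and Tc: "T (a *\<^sub>C x) = a *\<^sub>C T x" for a x
    using assms by (auto simp: bounded_clinear_def)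
  have scale: "bounded_linear (\<lambda>x::'a. c *\<^sub>C x)"
    by (rule bounded_linear_intro[where K = "cmod c"])
      (auto simp: scaleC_add_right scaleR_scaleC scaleC_scaleC norm_scaleC mult.commute)
  have "bounded_linear (id_plus c T)"
    unfolding id_plus_def
    by (intro bounded_linear_add bounded_linear_ident bounded_linear_compose[OF scale T])
  then show ?thesis
    by (auto simp: bounded_clinear_def id_plus_def Tc scaleC_add_right scaleC_scaleC mult.commute)
qed

lemma coercive_norm_le:
  fixes x u :: "'a::complex_inner"
  assumes "c > 0" and "Re (a * cinner u x) \<ge> c * (norm x)\<^sup>2"
  shows "norm x \<le> norm u * (cmod a / c)"
proof (cases "x = 0")
  case True
  then show ?thesis using assms(1) by simp
next
  case False
  have "c * (norm x)\<^sup>2 \<le> cmod (a * cinner u x)"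
    using assms(2) complex_Re_le_cmod order_trans by blast
  also have "\<dots> \<le> cmod a * (norm u * norm x)"
    by (simp add: norm_mult mult_left_mono Cauchy_Schwarz_cinner)
  finally have "(c * norm x) * norm x \<le> (cmod a * norm u) * norm x"
    by (simp add: power2_eq_square mult.assoc)
  then have "c * norm x \<le> cmod a * norm u"
    using False by simp
  then show ?thesis
    using assms(1) by (simp add: field_simps)
qed

text \<open>
  The Lax--Milgram argument.  Solving \<open>A x = y\<close> means finding a fixed point of
  \<open>x \<mapsto> x - \<rho> a (A x - y)\<close>, and
  \<open>\<parallel>d - \<rho> a A d\<parallel>\<^sup>2 \<le> (1 - 2 \<rho> c + \<rho>\<^sup>2 M\<^sup>2) \<parallel>d\<parallel>\<^sup>2\<close> if \<open>\<parallel>a A d\<parallel> \<le> M \<parallel>d\<parallel>\<close>, so that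
  the map is a contraction for small \<open>\<rho> > 0\<close>.
\<close>

lemma coercive_imp_surj:
  fixes A :: "'a::complex_hilbert \<Rightarrow> 'a"
  assumes A: "bounded_clinear A" and c: "c > 0"
    and coercive: "\<And>x. Re (a * cinner (A x) x) \<ge> c * (norm x)\<^sup>2"
  shows "surj A"
proof -
  have lin: "bounded_linear A"
    using A by (simp add: bounded_clinear_def)
  obtain K where K: "K > 0" "\<And>x. norm (A x) \<le> norm x * K"
    using bounded_linear.pos_bounded[OF lin] by blast
  \<comment> \<open>The summand \<open>c\<close> ensures \<open>c \<le> M\<close>, so that the root below is of a nonnegative number.\<close>
  define M where "M = cmod a * K + c"
  have M: "M \<ge> c" "M > 0"
    using K c by (auto simp: M_def add_nonneg_pos)
  have bound: "cmod a * norm (A x) \<le> M * norm x" for x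
  proof -
    have "cmod a * norm (A x) \<le> cmod a * (norm x * K)"
      by (intro mult_left_mono K) auto
    also have "\<dots> \<le> M * norm x"
      using c by (simp add: M_def algebra_simps)
    finally show ?thesis .
  qed
  \<comment> \<open>The minimiser of \<open>1 - 2 \<rho> c + \<rho>\<^sup>2 M\<^sup>2\<close>, with minimum \<open>q\<^sup>2\<close>.\<close>
  define \<rho> where "\<rho> = c / M\<^sup>2"
  define q where "q = sqrt (1 - (c / M)\<^sup>2)"
  have cM: "0 < c / M" "c / M \<le> 1"
    using M c by auto
  have "(c / M)\<^sup>2 \<le> 1" "(c / M)\<^sup>2 > 0"
    using cM by (auto simp: power_le_one simp del: power_divide)
  then have q: "0 \<le> q" "q < 1" "q\<^sup>2 = 1 - (c / M)\<^sup>2"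
    by (auto simp: q_def simp del: power_divide)
  have \<rho>: "\<rho> > 0" "1 - 2 * \<rho> * c + \<rho>\<^sup>2 * M\<^sup>2 = q\<^sup>2"
  proof -
    show "\<rho> > 0"
      using M c by (simp add: \<rho>_def)
    have "\<rho> * c = (c / M)\<^sup>2" "\<rho>\<^sup>2 * M\<^sup>2 = (c / M)\<^sup>2"
      using M by (auto simp: \<rho>_def power2_eq_square)
    then show "1 - 2 * \<rho> * c + \<rho>\<^sup>2 * M\<^sup>2 = q\<^sup>2"
      by (simp add: q(3) mult.assoc del: power_divide)
  qed
  have contract: "norm (d + (- \<rho> * a) *\<^sub>C A d) \<le> q * norm d" for d
  proof -
    have "(norm (d + (- \<rho> * a) *\<^sub>C A d))\<^sup>2
        = (norm d)\<^sup>2 - 2 * \<rho> * Re (cnj a * cinner d (A d)) + \<rho>\<^sup>2 * (cmod a * norm (A d))\<^sup>2"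
      using \<rho>(1) by (simp add: norm_add_sq cinner_scaleC_right norm_scaleC norm_mult
          power_mult_distrib algebra_simps)
    also have "Re (cnj a * cinner d (A d)) = Re (a * cinner (A d) d)"
      by (subst cinner_commute) (simp add: algebra_simps)
    also have "(norm d)\<^sup>2 - 2 * \<rho> * Re (a * cinner (A d) d) + \<rho>\<^sup>2 * (cmod a * norm (A d))\<^sup>2
        \<le> (norm d)\<^sup>2 - 2 * \<rho> * (c * (norm d)\<^sup>2) + \<rho>\<^sup>2 * (M * norm d)\<^sup>2"
      using \<rho>(1) by (intro add_mono diff_mono mult_left_mono power_mono coercive bound) auto
    also have "\<dots> = (1 - 2 * \<rho> * c + \<rho>\<^sup>2 * M\<^sup>2) * (norm d)\<^sup>2"
      by (simp add: algebra_simps power_mult_distrib)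
    also have "\<dots> = (q * norm d)\<^sup>2"
      by (simp add: \<rho>(2) power_mult_distrib)
    finally show ?thesis
      by (rule power2_le_imp_le) (use q in auto)
  qed
  have "\<exists>x. A x = y" for y
  proof -
    define f where "f x = x + (- \<rho> * a) *\<^sub>C (A x - y)" for x
    have "dist (f u) (f v) \<le> q * dist u v" for u v
    proof -
      have "f u - f v = (u - v) + (- \<rho> * a) *\<^sub>C A (u - v)"
        by (simp add: f_def linear_diff[OF bounded_linear.linear[OF lin]] scaleC_diff_right algebra_simps)
      then show ?thesis
        using contract[of "u - v"] by (simp add: dist_norm)
    qed
    then obtain x where "f x = x"
      using banach_fix_type[of q f] q by auto
    then have "norm ((- \<rho> * a) *\<^sub>C (A x - y)) = 0"
      by (simp add: f_def)
    moreover have "a \<noteq> 0 \<or> x = y" for x y :: 'a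
      using coercive[of "x - y"] c by (auto simp: mult_le_0_iff)
    ultimately show ?thesis
      using \<rho>(1) by (auto simp: norm_scaleC)
  qed
  then show ?thesis
    by (metis surjI surj_def)
qed

lemma coercive_imp_invertible:
  fixes A :: "'a::complex_hilbert \<Rightarrow> 'a"
  assumes A: "bounded_clinear A" and c: "c > 0"
    and coercive: "\<And>x. Re (a * cinner (A x) x) \<ge> c * (norm x)\<^sup>2"
  shows "invertible_op A"
proof -
  have lin: "bounded_linear A" and Ac: "A (b *\<^sub>C x) = b *\<^sub>C A x" for b x
    using A by (auto simp: bounded_clinear_def)
  have surj: "surj A"
    using assms by (rule coercive_imp_surj)
  have lower: "norm x \<le> norm (A x) * (cmod a / c)" for x
    using c coercive by (rule coercive_norm_le)
  have inj: "inj A"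
  proof (rule injI)
    fix x y assume "A x = A y"
    then have "norm (x - y) \<le> 0"
      using lower[of "x - y"] by (simp add: linear_diff[OF bounded_linear.linear[OF lin]])
    then show "x = y" by simp
  qed
  have AB: "A (inv A y) = y" for y
    using surj by (rule surj_f_inv_f)
  have BA: "inv A (A x) = x" for x
    using inj by (rule inv_f_f)
  have B: "inv A y = x" if "A x = y" for x y
    using that BA by blast
  have "bounded_linear (inv A)"
  proof (rule bounded_linear_intro)
    show "inv A (x + y) = inv A x + inv A y" for x y
      by (rule B) (simp add: linear_add[OF bounded_linear.linear[OF lin]] AB)
    show "inv A (r *\<^sub>R x) = r *\<^sub>R inv A x" for r x
      by (rule B) (simp add: linear_scale[OF bounded_linear.linear[OF lin]] AB)
    show "norm (inv A x) \<le> norm x * (cmod a / c)" for x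
      using lower[of "inv A x"] by (simp add: AB)
  qed
  moreover have "inv A (b *\<^sub>C x) = b *\<^sub>C inv A x" for b x
    by (rule B) (simp add: Ac AB)
  ultimately have "bounded_clinear (inv A)"
    by (simp add: bounded_clinear_def)
  then show ?thesis
    using A AB BA by (auto simp: invertible_op_def fun_eq_iff)
qed

section \<open>Operators whose inverse has the half-plane as numerical range\<close>

lemma norm_id_plus_sq:
  "(norm (id_plus c T x))\<^sup>2
    = (norm x)\<^sup>2 + 2 * Re (cnj c * cinner x (T x)) + (cmod c)\<^sup>2 * (norm (T x))\<^sup>2"
  by (simp add: id_plus_def norm_add_sq cinner_scaleC_right norm_scaleC power_mult_distrib)

lemma numerical_range_inv:
  assumes "inj T"
  shows "numerical_range (range T) (inv T) = {cinner x (T x) | x. norm (T x) = 1}"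
proof -
  have "numerical_range (range T) (inv T) = {cinner (inv T (T x)) (T x) | x. norm (T x) = 1}"
    unfolding numerical_range_def by blast
  then show ?thesis
    by (simp add: inv_f_f[OF assms])
qed

lemma rescale_to_unit_image:
  assumes T: "bounded_clinear T" and inj: "inj T" and x: "x \<noteq> 0"
  obtains u s where "x = complex_of_real s *\<^sub>C u" "s > 0" "norm (T u) = 1"
    "cinner u (T u) \<in> numerical_range (range T) (inv T)"
proof -
  have lin: "bounded_linear T"
    using T by (simp add: bounded_clinear_def)
  define s where "s = norm (T x)"
  have "T x \<noteq> 0"
    using x inj linear_0[OF bounded_linear.linear[OF lin]] by (metis injD)
  then have s: "s > 0" by (simp add: s_def)
  define u where "u = (1 / s) *\<^sub>R x"
  have "x = complex_of_real s *\<^sub>C u"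
    using s by (simp add: u_def flip: scaleR_scaleC)
  moreover have "norm (T u) = 1"
    using s by (simp add: u_def s_def linear_scale[OF bounded_linear.linear[OF lin]])
  ultimately show ?thesis
    using that s numerical_range_inv[OF inj] by blast
qed

lemma Re_cinner_nonneg:
  assumes T: "bounded_clinear T" and inj: "inj T"
    and W: "numerical_range (range T) (inv T) \<subseteq> {z. Re z \<ge> 0}"
  shows "Re (cinner x (T x)) \<ge> 0"
proof (cases "x = 0")
  case True
  have "T 0 = 0"
    using T by (auto simp: bounded_clinear_def linear_0 bounded_linear.linear)
  then show ?thesis
    using True cinner_self[of "0::'a"] by simp
next
  case False
  then obtain u s where u: "x = complex_of_real s *\<^sub>C u" "s > 0"
    "cinner u (T u) \<in> numerical_range (range T) (inv T)"
    using rescale_to_unit_image[OF T inj] by metis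
  have "T x = complex_of_real s *\<^sub>C T u"
    using T by (simp add: bounded_clinear_def u(1))
  then have "cinner x (T x) = complex_of_real s * (complex_of_real s * cinner u (T u))"
    by (simp add: u(1) cinner_scaleC_left cinner_scaleC_right)
  then show ?thesis
    using u W by auto
qed

text \<open>
  Multiplying by \<open>cnj \<mu>\<close> moves the accretive part to
  \<open>\<bar>\<mu>\<bar>\<^sup>2 \<langle>T x, x\<rangle>\<close> and leaves \<open>cnj \<mu> \<parallel>x\<parallel>\<^sup>2\<close>, so \<open>Re \<mu>\<close> is a coercivity constant.
\<close>

lemma invertible_id_plus:
  fixes T :: "'a::complex_hilbert \<Rightarrow> 'a"
  assumes T: "bounded_clinear T" and accretive: "\<And>x. Re (cinner x (T x)) \<ge> 0" and mu: "Re mu > 0"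
  shows "invertible_op (id_plus mu T)"
proof (rule coercive_imp_invertible[OF bounded_clinear_id_plus[OF T] mu])
  fix x
  have "cnj mu * cinner (id_plus mu T x) x
      = cnj mu * complex_of_real ((norm x)\<^sup>2) + complex_of_real ((cmod mu)\<^sup>2) * cinner (T x) x"
    unfolding complex_norm_square
    by (simp add: id_plus_def cinner_add_left cinner_scaleC_left cinner_self algebra_simps)
  then have "Re (cnj mu * cinner (id_plus mu T x) x)
      = Re mu * (norm x)\<^sup>2 + (cmod mu)\<^sup>2 * Re (cinner (T x) x)"
    by simp
  moreover have "Re (cinner (T x) x) \<ge> 0"
    using accretive[of x] by (subst cinner_commute) simp
  ultimately show "Re mu * (norm x)\<^sup>2 \<le> Re (cnj mu * cinner (id_plus mu T x) x)"
    by simp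
qed

lemma id_plus_dominated_iff:
  assumes T: "bounded_clinear T" and inj: "inj T"
  shows "(\<forall>x. norm (id_plus lam T x) \<le> norm (id_plus mu T x)) \<longleftrightarrow>
    (\<forall>z \<in> numerical_range (range T) (inv T).
      0 \<le> 2 * Re (cnj (mu - lam) * z) + ((cmod mu)\<^sup>2 - (cmod lam)\<^sup>2))" (is "?L \<longleftrightarrow> ?R")
proof -
  have unit: "norm (id_plus lam T u) \<le> norm (id_plus mu T u) \<longleftrightarrow>
      0 \<le> 2 * Re (cnj (mu - lam) * cinner u (T u)) + ((cmod mu)\<^sup>2 - (cmod lam)\<^sup>2)"
    if "norm (T u) = 1" for u
  proof -
    have "norm (id_plus lam T u) \<le> norm (id_plus mu T u) \<longleftrightarrow>
        (norm (id_plus lam T u))\<^sup>2 \<le> (norm (id_plus mu T u))\<^sup>2"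
      by (simp add: power_mono_iff)
    then show ?thesis
      unfolding norm_id_plus_sq that by (simp add: algebra_simps)
  qed
  have scale: "id_plus c T (a *\<^sub>C u) = a *\<^sub>C id_plus c T u" for c a u
    using bounded_clinear_id_plus[OF T] by (simp add: bounded_clinear_def)
  show ?thesis
  proof
    assume ?L
    then show ?R
      unfolding numerical_range_inv[OF inj] using unit by blast
  next
    assume R: ?R
    show ?L
    proof
      fix x
      show "norm (id_plus lam T x) \<le> norm (id_plus mu T x)"
      proof (cases "x = 0")
        case True
        have "bounded_linear (id_plus c T)" for c
          using bounded_clinear_id_plus[OF T] by (simp add: bounded_clinear_def)
        then show ?thesis
          using True by (simp add: linear_0 bounded_linear.linear)
      next
        case False
        then obtain u s where u: "x = complex_of_real s *\<^sub>C u" "s > 0" "norm (T u) = 1"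
          "cinner u (T u) \<in> numerical_range (range T) (inv T)"
          using rescale_to_unit_image[OF T inj] by metis
        have "norm (id_plus lam T u) \<le> norm (id_plus mu T u)"
          using unit[OF u(3)] R u(4) by blast
        then show ?thesis
          using u(2) by (simp add: u(1) scale norm_scaleC mult_left_mono)
      qed
    qed
  qed
qed

lemma affine_nonneg_on_half_plane_iff:
  "(\<forall>z \<in> {z. Re z \<ge> 0}. 0 \<le> 2 * Re (cnj d * z) + k) \<longleftrightarrow> Im d = 0 \<and> Re d \<ge> 0 \<and> k \<ge> 0"
  (is "?L \<longleftrightarrow> ?R")
proof
  assume L: ?L
  then have k: "k \<ge> 0"
    by (metis (no_types, lifting) add_0 mem_Collect_eq mult_zero_right order_refl zero_complex.sel(1))
  have "Im d = 0"
  proof (rule ccontr)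
    assume "Im d \<noteq> 0"
    moreover have "0 \<le> 2 * Re (cnj d * Complex 0 (- (k + 1) / (2 * Im d))) + k"
      using L by (metis complex.sel(1) mem_Collect_eq order_refl)
    ultimately show False
      by (simp add: field_simps)
  qed
  moreover have "Re d \<ge> 0"
  proof (rule ccontr)
    assume neg: "\<not> Re d \<ge> 0"
    have "0 \<le> 2 * Re (cnj d * Complex (- (k + 1) / (2 * Re d)) 0) + k"
      by (rule bspec[OF L]) (use k neg in \<open>auto simp: divide_le_0_iff zero_le_divide_iff\<close>)
    then show False
      using neg by (simp add: field_simps)
  qed
  ultimately show ?R
    using k by simp
next
  assume ?R
  then show ?L
    by simp
qed

lemma affine_nonneg_iff_reflected_segment:
  assumes "lam \<noteq> mu"
  shows "(\<forall>z \<in> {z. Re z \<ge> 0}. 0 \<le> 2 * Re (cnj (mu - lam) * z) + ((cmod mu)\<^sup>2 - (cmod lam)\<^sup>2))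
    \<longleftrightarrow> Re mu > 0 \<and> lam \<in> reflected_segment mu" (is "?L \<longleftrightarrow> ?R")
proof -
  define r where "r = Re (mu - lam)"
  have "?L \<longleftrightarrow> Im lam = Im mu \<and> 0 \<le> r \<and> (cmod lam)\<^sup>2 \<le> (cmod mu)\<^sup>2"
    unfolding affine_nonneg_on_half_plane_iff by (auto simp: r_def)
  also have "\<dots> \<longleftrightarrow> Im lam = Im mu \<and> 0 < r \<and> r \<le> 2 * Re mu"
  proof -
    have "r \<noteq> 0" if "Im lam = Im mu"
      using that assms by (auto simp: r_def complex_eq_iff)
    moreover have "(cmod lam)\<^sup>2 \<le> (cmod mu)\<^sup>2 \<longleftrightarrow> r * r \<le> r * (2 * Re mu)" if "Im lam = Im mu"
      using that unfolding cmod_power2 r_def by (simp add: power2_eq_square algebra_simps)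
    ultimately show ?thesis
      by (auto simp: less_le)
  qed
  also have "\<dots> \<longleftrightarrow> ?R"
  proof
    assume *: "Im lam = Im mu \<and> 0 < r \<and> r \<le> 2 * Re mu"
    \<comment> \<open>The point of the segment with parameter \<open>t\<close> is \<open>\<mu> - 2 (1 - t) Re \<mu>\<close>.\<close>
    define t where "t = 1 - r / (2 * Re mu)"
    have "t \<in> {0..<1}" "lam = - complex_of_real (1 - t) * cnj mu + complex_of_real t * mu"
      using * by (auto simp: t_def complex_eq_iff field_simps r_def)
    then show ?R
      using * by (auto simp: reflected_segment_def)
  next
    assume R: ?R
    then obtain t where t: "0 \<le> t" "t < 1"
      "lam = - complex_of_real (1 - t) * cnj mu + complex_of_real t * mu"
      by (auto simp: reflected_segment_def)
    have "r = 2 * Re mu * (1 - t)"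
      by (simp add: r_def t(3) algebra_simps)
    moreover have "Im lam = Im mu"
      by (simp add: t(3) algebra_simps)
    moreover have "2 * Re mu * (1 - t) \<le> 2 * Re mu * 1"
      using R t by (intro mult_left_mono) auto
    ultimately show "Im lam = Im mu \<and> 0 < r \<and> r \<le> 2 * Re mu"
      using R t by simp
  qed
  finally show ?thesis .
qed

text \<open>
  If \<open>\<mu> - \<lambda>\<close> is real, the points \<open>w = i n\<close> contribute nothing to
  \<open>Re (cnj (\<mu> - \<lambda>) w)\<close>, so \<open>\<parallel>(I + \<lambda>T)x\<parallel>\<^sup>2\<close> and \<open>\<parallel>(I + \<mu>T)x\<parallel>\<^sup>2\<close> differ by a constant, while
  both grow without bound as \<open>n\<close> does.  So their ratio comes arbitrarily close to 1.
\<close>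

lemma no_strict_domination:
  assumes inj: "inj T"
    and W: "\<And>y::real. \<i> * y \<in> numerical_range (range T) (inv T)"
    and real: "Im lam = Im mu"
    and q: "0 \<le> q" "\<And>x. norm (id_plus lam T x) \<le> q * norm (id_plus mu T x)"
  shows "q \<ge> 1"
proof (rule ccontr)
  assume "\<not> q \<ge> 1"
  then have q2: "1 - q\<^sup>2 > 0"
    using q(1) by (simp add: power_less_one_iff abs_square_less_1)
  define k where "k = (cmod mu)\<^sup>2 - (cmod lam)\<^sup>2"
  \<comment> \<open>With this \<open>n\<close> the gap \<open>k\<close> is below \<open>(1 - q\<^sup>2) n\<^sup>2\<close>.\<close>
  define n where "n = \<bar>k\<bar> / (1 - q\<^sup>2) + 1"
  have "(1 - q\<^sup>2) * n = \<bar>k\<bar> + (1 - q\<^sup>2)"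
    using q2 by (simp add: n_def distrib_left)
  then have n: "n \<ge> 1" "(1 - q\<^sup>2) * n > k"
    using q2 by (auto simp: n_def)
  have "\<i> * complex_of_real (n + cmod mu) \<in> {cinner x (T x) | x. norm (T x) = 1}"
    using W[of "n + cmod mu"] by (simp add: numerical_range_inv[OF inj])
  then obtain x where x: "norm (T x) = 1" "cinner x (T x) = \<i> * complex_of_real (n + cmod mu)"
    by force
  have "n + cmod mu = cmod (cinner x (T x))"
    using n by (simp add: x(2) norm_mult del: of_real_add)
  also have "\<dots> \<le> norm x"
    using Cauchy_Schwarz_cinner[of x "T x"] x(1) by simp
  also have "\<dots> \<le> norm (id_plus mu T x) + norm (mu *\<^sub>C T x)"
    unfolding id_plus_def by (metis add_diff_cancel_right' norm_triangle_ineq4)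
  finally have "n \<le> norm (id_plus mu T x)"
    by (simp add: norm_scaleC x(1))
  then have "n * n \<le> (norm (id_plus mu T x))\<^sup>2"
    using n(1) by (simp add: power2_eq_square mult_mono)
  moreover have "n \<le> n * n"
    using n(1) by simp
  ultimately have "(1 - q\<^sup>2) * n \<le> (1 - q\<^sup>2) * (norm (id_plus mu T x))\<^sup>2"
    using q2 by (intro mult_left_mono) auto
  also have "\<dots> \<le> (norm (id_plus mu T x))\<^sup>2 - (norm (id_plus lam T x))\<^sup>2"
    using power_mono[OF q(2)[of x], of 2] by (simp add: power_mult_distrib algebra_simps)
  also have "\<dots> = k"
    unfolding norm_id_plus_sq x k_def by (simp add: real)
  finally show False
    using n(2) by simp
qed

section \<open>Norm of the fractional linear transform\<close>

lemma onorm_comp_inv_le_iff: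
  assumes S: "bounded_clinear S" and A: "invertible_op A" and q: "0 \<le> q"
  shows "onorm (S \<circ> inv A) \<le> q \<longleftrightarrow> (\<forall>x. norm (S x) \<le> q * norm (A x))"
proof -
  obtain B where B: "bounded_clinear B" "A \<circ> B = id" "B \<circ> A = id"
    using A by (auto simp: invertible_op_def)
  then have AB: "A (B y) = y" and BA: "B (A x) = x" for x y
    by (auto simp: fun_eq_iff)
  have inv: "inv A = B"
    using B(2,3) by (rule inv_unique_comp)
  have "bounded_linear (S \<circ> B)"
    using S B(1) by (auto simp: bounded_clinear_def comp_def intro: bounded_linear_compose)
  then have "norm (S (B y)) \<le> onorm (S \<circ> B) * norm y" for y
    using onorm[of "S \<circ> B" y] by simp
  then have "norm (S (B y)) \<le> q * norm y" if "onorm (S \<circ> B) \<le> q" for y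
    using mult_right_mono[OF that norm_ge_zero[of y]] order_trans by blast
  then have "norm (S x) \<le> q * norm (A x)" if "onorm (S \<circ> B) \<le> q" for x
    using that BA by metis
  moreover have "onorm (S \<circ> B) \<le> q" if "\<forall>x. norm (S x) \<le> q * norm (A x)"
    using that AB q by (intro onorm_bound) (auto, metis)
  ultimately show ?thesis
    unfolding inv by blast
qed

theorem theorem1p2:
  fixes T :: "'a::complex_hilbert \<Rightarrow> 'a" and lam mu :: complex
  assumes "bounded_clinear T" and "inj T"
    and "numerical_range (range T) (inv T) = {z. Re z \<ge> 0}"
    and "lam \<noteq> mu"
  shows "(invertible_op (id_plus mu T) \<and> onorm (id_plus lam T \<circ> inv (id_plus mu T)) = 1)
    \<longleftrightarrow> (Re mu > 0 \<and> lam \<in> reflected_segment mu)"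
proof -
  let ?Q = "onorm (id_plus lam T \<circ> inv (id_plus mu T))"
  have S: "bounded_clinear (id_plus lam T)"
    using assms(1) by (rule bounded_clinear_id_plus)
  have dominated: "(\<forall>x. norm (id_plus lam T x) \<le> norm (id_plus mu T x)) \<longleftrightarrow>
      Re mu > 0 \<and> lam \<in> reflected_segment mu"
    unfolding id_plus_dominated_iff[OF assms(1,2)] assms(3)
    by (rule affine_nonneg_iff_reflected_segment[OF assms(4)])
  show ?thesis
  proof
    assume "invertible_op (id_plus mu T) \<and> ?Q = 1"
    then show "Re mu > 0 \<and> lam \<in> reflected_segment mu"
      using onorm_comp_inv_le_iff[OF S, of "id_plus mu T" 1] dominated by simp
  next
    assume R: "Re mu > 0 \<and> lam \<in> reflected_segment mu"
    have inv: "invertible_op (id_plus mu T)"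
      using Re_cinner_nonneg[OF assms(1,2)] assms(3) R
      by (intro invertible_id_plus[OF assms(1)]) auto
    have "?Q \<le> 1"
      using onorm_comp_inv_le_iff[OF S inv, of 1] dominated R by simp
    moreover have "?Q \<ge> 1"
    proof (rule no_strict_domination[OF assms(2)])
      show "\<i> * complex_of_real y \<in> numerical_range (range T) (inv T)" for y
        by (simp add: assms(3))
      show "Im lam = Im mu"
        using affine_nonneg_iff_reflected_segment[OF assms(4)] R
        unfolding affine_nonneg_on_half_plane_iff by simp
      obtain B where "bounded_clinear B" "inv (id_plus mu T) = B"
        using inv inv_unique_comp by (metis invertible_op_def)
      then have "bounded_linear (id_plus lam T \<circ> inv (id_plus mu T))"
        using S by (auto simp: bounded_clinear_def comp_def intro: bounded_linear_compose)
      then show "0 \<le> ?Q"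
        by (rule onorm_pos_le)
      then show "norm (id_plus lam T x) \<le> ?Q * norm (id_plus mu T x)" for x
        using onorm_comp_inv_le_iff[OF S inv] by blast
    qed
    ultimately show "invertible_op (id_plus mu T) \<and> ?Q = 1"
      using inv by simp
  qed
qed

end
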